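(* If $P$ is a $k\times n$ transportation polytope, then $\text{mono-diam}(P)\le e\cdot k!\,n^k$, where $e$ is the base of the natural logarithm. Therefore, for fixed $k$, the monotone diameter of $k\times n$ transportation polytopes is bounded by a polynomial in $n$.
   Context: A $k\times n$ transportation polytope is given by supplies $a_1,\dots,a_k>0$ and demands $b_1,\dots,b_n>0$ with $\sum_i a_i=\sum_j b_j$; it is the set of $x\in\mathbb{R}^{k\times n}$ with $x\ge0$, $\sum_j x_{ij}=a_i$ for all $i$, $\sum_i x_{ij}=b_j$ for all $j$. For a polytope $Q$, a linear objective function $c$ (to be minimized) is nondegenerate if no two vertices of $Q$ have the same objective value; each edge of $Q$ is then oriented toward its endpoint of smaller value. A $c$-monotone path is a directed path in this oriented graph from some vertex to the optimal vertex; its length is its number of edges. The $c$-monotone diameter of $Q$ is the maximum, over all starting vertices, of the length of a shortest $c$-monotone path from that vertex. The monotone diameter $\text{mono-diam}(Q)$ is the maximum of the $c$-monotone diameters over all nondegenerate linear objectives $c$. *)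

theory Defs
  imports "HOL-Analysis.Analysis" "HOL-Analysis.Finite_Function_Topology"
    "HOL-Computational_Algebra.Polynomial" "HOL-Library.Extended_Real"
begin

text \<open>
  A \<open>k \<times> n\<close> matrix is a finitely supported function on pairs of naturals whose support lies
  in \<open>{..<k} \<times> {..<n}\<close> (indices start at 0). All sizes thus live in one real vector space,
  so that \<open>k\<close> and \<open>n\<close> can be quantified over inside a formula. The library notions
  \<^const>\<open>face_of\<close> and \<^const>\<open>extreme_point_of\<close> depend only on the set,
  not on the ambient space.
\<close>

type_synonym matrix = "(nat \<times> nat) \<Rightarrow>\<^sub>0 real"

definition transportation_polytope ::
    "nat \<Rightarrow> nat \<Rightarrow> (nat \<Rightarrow> real) \<Rightarrow> (nat \<Rightarrow> real) \<Rightarrow> matrix set" where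
  "transportation_polytope k n a b =
     {x. Poly_Mapping.keys x \<subseteq> {..<k} \<times> {..<n} \<and>
         (\<forall>i<k. \<forall>j<n. 0 \<le> Poly_Mapping.lookup x (i, j)) \<and>
         (\<forall>i<k. (\<Sum>j<n. Poly_Mapping.lookup x (i, j)) = a i) \<and>
         (\<forall>j<n. (\<Sum>i<k. Poly_Mapping.lookup x (i, j)) = b j)}"

definition is_transportation_polytope :: "nat \<Rightarrow> nat \<Rightarrow> matrix set \<Rightarrow> bool" where
  "is_transportation_polytope k n P \<longleftrightarrow>
     (\<exists>a b. (\<forall>i<k. 0 < a i) \<and> (\<forall>j<n. 0 < b j) \<and> (\<Sum>i<k. a i) = (\<Sum>j<n. b j) \<and>
            P = transportation_polytope k n a b)"

text \<open>
  The library's \<^const>\<open>edge_of\<close> needs a Euclidean space because it uses \<^const>\<open>aff_dim\<close>.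
  The following notion makes sense in every real vector space; \<open>edge_of_iff_edge_between\<close>
  below shows that it agrees with \<^const>\<open>edge_of\<close> for polytopes in Euclidean space.
\<close>

definition edge_between :: "'a::real_vector set \<Rightarrow> 'a \<Rightarrow> 'a \<Rightarrow> bool" where
  "edge_between P u v \<longleftrightarrow> u \<noteq> v \<and> closed_segment u v face_of P"

lemma edge_of_iff_edge_between:
  fixes P :: "'a::euclidean_space set"
  assumes "polytope P"
  shows "e edge_of P \<longleftrightarrow> (\<exists>u v. e = closed_segment u v \<and> edge_between P u v)"
proof
  assume e: "e edge_of P"
  then have f: "e face_of P" and d: "aff_dim e = 1"
    by (auto simp: edge_of_def)
  have "polytope e"
    using assms f by (rule face_of_polytope_polytope)
  then have "compact e" "convex e"
    by (auto simp: polytope_imp_compact polytope_imp_convex)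
  moreover have "collinear e"
    using d by (simp add: collinear_aff_dim)
  moreover have "e \<noteq> {}"
    using d by auto
  ultimately obtain u v where uv: "e = closed_segment u v"
    using compact_convex_collinear_segment by metis
  moreover have "u \<noteq> v"
    using d uv by auto
  ultimately show "\<exists>u v. e = closed_segment u v \<and> edge_between P u v"
    using f by (auto simp: edge_between_def)
next
  assume "\<exists>u v. e = closed_segment u v \<and> edge_between P u v"
  then obtain u v where e: "e = closed_segment u v" "u \<noteq> v" "e face_of P"
    by (auto simp: edge_between_def)
  have "aff_dim e = aff_dim {u, v}"
    using e(1) by (metis aff_dim_convex_hull segment_convex_hull)
  then have "aff_dim e = 1"
    using e(2) by (simp add: aff_dim_2)
  then show "e edge_of P"
    using e(3) by (simp add: edge_of_def)
qed

definition vertices :: "'a::real_vector set \<Rightarrow> 'a set" where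
  "vertices P = {v. v extreme_point_of P}"

text \<open>
  For a matrix polytope, \<open>c\<close> is a linear functional on the whole space of finitely supported
  functions; its restrictions to the \<open>k \<times> n\<close> matrices are exactly the linear functionals there.
\<close>

definition nondegenerate_objective :: "'a::real_vector set \<Rightarrow> ('a \<Rightarrow> real) \<Rightarrow> bool" where
  "nondegenerate_objective P c \<longleftrightarrow> linear c \<and> inj_on c (vertices P)"

definition directed_edges :: "'a::real_vector set \<Rightarrow> ('a \<Rightarrow> real) \<Rightarrow> ('a \<times> 'a) set" where
  "directed_edges P c =
     {(u, v). u \<in> vertices P \<and> v \<in> vertices P \<and> edge_between P u v \<and> c v < c u}"

definition optimal_vertex :: "'a::real_vector set \<Rightarrow> ('a \<Rightarrow> real) \<Rightarrow> 'a \<Rightarrow> bool" where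
  "optimal_vertex P c w \<longleftrightarrow> w \<in> vertices P \<and> (\<forall>x\<in>P. c w \<le> c x)"

text \<open>
  Lengths are taken in \<^typ>\<open>enat\<close>: the infimum is \<open>\<infinity>\<close> if there is no path, and the suprema
  below are \<open>\<infinity>\<close> if there is no bound. Walks in \<^const>\<open>directed_edges\<close> never revisit a vertex
  because \<open>c\<close> strictly decreases.
\<close>

definition monotone_distance :: "'a::real_vector set \<Rightarrow> ('a \<Rightarrow> real) \<Rightarrow> 'a \<Rightarrow> enat" where
  "monotone_distance P c v =
     Inf {enat l | l w. optimal_vertex P c w \<and> (v, w) \<in> directed_edges P c ^^ l}"

definition objective_mono_diam :: "'a::real_vector set \<Rightarrow> ('a \<Rightarrow> real) \<Rightarrow> enat" where
  "objective_mono_diam P c = (SUP v \<in> vertices P. monotone_distance P c v)"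

definition mono_diam :: "'a::real_vector set \<Rightarrow> enat" where
  "mono_diam P = (SUP c \<in> {c. nondegenerate_objective P c}. objective_mono_diam P c)"

end

theory Submission
  imports Defs "HOL-Combinatorics.Permutations"
begin

text \<open>
  Fix a start vertex \<open>v\<close> and a generic linear functional \<open>d\<close> minimized over \<open>P\<close> exactly at \<open>v\<close>.
  As \<open>\<kappa>\<close> grows from \<open>0\<close>, the minimizers of \<open>d + \<kappa> c\<close> trace the shadow vertex path from \<open>v\<close> to the
  \<open>c\<close>-optimal vertex. An edge with direction \<open>g\<close> is traversed at the parameter \<open>\<kappa> = - d g / c g\<close>;
  these parameters strictly increase along the path, so no edge direction occurs twice. The edge
  directions of a \<open>k \<times> n\<close> transportation polytope are alternating cycles of the complete bipartite
  graph, and those through \<open>l\<close> rows number at most \<open>(k choose l) l! n^l \<le> k! n^k / (k - l)!\<close>;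
  summing over \<open>l\<close> gives \<open>e k! n^k\<close>.
\<close>

subsection \<open>Shadow vertex paths\<close>

text \<open>A combination with positive weights of two values that are at least \<open>m\<close>
  equals \<open>m\<close> only if both values do.\<close>

lemma min_face_of:
  fixes S :: "'a::real_vector set" and f :: "'a \<Rightarrow> real"
  assumes "convex S" "linear f" and min: "\<And>x. x \<in> S \<Longrightarrow> m \<le> f x"
  shows "{x \<in> S. f x = m} face_of S"
proof -
  interpret f: linear f by fact
  have "convex {x \<in> S. f x = m}"
    using convex_Int[OF \<open>convex S\<close> convex_linear_vimage[OF \<open>linear f\<close> convex_singleton[of m]]]
    by (simp add: Int_def)
  moreover have "f a = m \<and> f b = m"
    if ab: "a \<in> S" "b \<in> S" "x \<in> open_segment a b" "f x = m" for a b x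
  proof -
    obtain u where u: "0 < u" "u < 1" "x = (1 - u) *\<^sub>R a + u *\<^sub>R b"
      using ab by (auto simp: in_segment)
    have eq: "(1 - u) * (f a - m) + u * (f b - m) = 0"
      using arg_cong[OF u(3), of f] ab(4) by (simp only: f.add f.scale) (simp add: algebra_simps)
    have "0 \<le> (1 - u) * (f a - m)" "0 \<le> u * (f b - m)"
      using u min ab by (simp_all add: mult_nonneg_nonneg)
    then have "(1 - u) * (f a - m) = 0" "u * (f b - m) = 0"
      using eq by linarith+
    then show ?thesis using u by auto
  qed
  ultimately show ?thesis
    unfolding face_of_def by blast
qed

text \<open>Since extreme points of a face are extreme in the whole set, this makes the far end of
  an edge a vertex.\<close>

lemma extreme_point_of_closed_segment_right:
  fixes a b :: "'a::real_vector"
  shows "b extreme_point_of closed_segment a b"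
proof -
  have False if pq: "p \<in> closed_segment a b" "q \<in> closed_segment a b" "b \<in> open_segment p q" for p q
  proof -
    obtain s t where st: "p = a + s *\<^sub>R (b - a)" "s \<le> 1" "q = a + t *\<^sub>R (b - a)" "t \<le> 1"
      using pq(1,2) by (auto simp: in_segment algebra_simps)
    obtain u where u: "p \<noteq> q" "0 < u" "u < 1" "b = (1 - u) *\<^sub>R p + u *\<^sub>R q"
      using pq(3) by (auto simp: in_segment)
    have "a \<noteq> b" using st(1,3) u(1) by auto
    have "((1 - u) * (1 - s) + u * (1 - t)) *\<^sub>R (b - a) = b - ((1 - u) *\<^sub>R p + u *\<^sub>R q)"
      unfolding st by (simp add: algebra_simps)
    also have "\<dots> = 0"
      using u(4) by (metis diff_self)
    finally have "(1 - u) * (1 - s) + u * (1 - t) = 0"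
      using \<open>a \<noteq> b\<close> by simp
    moreover have "0 \<le> (1 - u) * (1 - s)" "0 \<le> u * (1 - t)"
      using st(2,4) u(2,3) by simp_all
    ultimately have "(1 - u) * (1 - s) = 0" "u * (1 - t) = 0"
      by linarith+
    then have "s = t" using u(2,3) by simp
    then show False using st(1,3) u(1) by simp
  qed
  then show ?thesis
    by (auto simp: extreme_point_of_def)
qed

section \<open>Finite sets of directions that generate all displacements\<close>

definition feasible_direction :: "'a::real_vector set \<Rightarrow> 'a \<Rightarrow> 'a \<Rightarrow> bool" where
  "feasible_direction P x g \<longleftrightarrow> (\<exists>t>0. x + t *\<^sub>R g \<in> P)"

text \<open>What the path argument needs to know about the polytope: \<open>conic\<close> makes the
  feasible directions in \<open>C\<close> generate every displacement from \<open>x\<close>, and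
  \<open>max_step\<close> plays the role of compactness along them.\<close>

locale direction_set =
  fixes P :: "'a::real_vector set" and C :: "'a set"
  assumes convex: "convex P"
    and finite: "finite C"
    and zero_notin: "0 \<notin> C"
    and max_step: "\<And>x g. x \<in> P \<Longrightarrow> g \<in> C \<Longrightarrow> feasible_direction P x g \<Longrightarrow>
      \<exists>t>0. x + t *\<^sub>R g \<in> P \<and> (\<forall>s>t. x + s *\<^sub>R g \<notin> P)"
    and conic: "\<And>x z. x \<in> P \<Longrightarrow> z \<in> P \<Longrightarrow>
      \<exists>t. (\<forall>g\<in>C. 0 \<le> t g \<and> (t g \<noteq> 0 \<longrightarrow> feasible_direction P x g)) \<and>
          z = x + (\<Sum>g\<in>C. t g *\<^sub>R g)"
begin

text \<open>By \<open>conic\<close>, \<open>f z - f x\<close> is a nonnegative combination of values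
  \<open>f g\<close> at feasible \<open>g\<close>, so a local test on finitely many directions gives
  global minimality.\<close>

lemma minimal_if_feasible_directions:
  fixes f :: "'a \<Rightarrow> real"
  assumes "linear f" "x \<in> P" "z \<in> P"
    and f: "\<And>g. g \<in> C \<Longrightarrow> feasible_direction P x g \<Longrightarrow> 0 \<le> f g"
  shows "f x \<le> f z"
proof -
  interpret f: linear f by fact
  obtain t where t: "\<forall>g\<in>C. 0 \<le> t g \<and> (t g \<noteq> 0 \<longrightarrow> feasible_direction P x g)"
    "z = x + (\<Sum>g\<in>C. t g *\<^sub>R g)"
    using conic assms by blast
  have "0 \<le> (\<Sum>g\<in>C. t g * f g)"
    using t f by (intro sum_nonneg) (metis mult_nonneg_nonneg mult_zero_left order_refl)
  then show ?thesis
    using t by (simp add: f.add f.sum f.scale)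
qed

text \<open>The minimizers of \<open>f\<close> form a face lying on the line through
  \<open>x\<close> along \<open>g\<close>. Extremality of \<open>x\<close> rules out backward points
  and the maximal step bounds the forward ones, so the face is a segment.\<close>

lemma edge_of_minimizers:
  fixes f :: "'a \<Rightarrow> real"
  assumes "linear f" "x \<in> vertices P" "g \<in> C" "feasible_direction P x g" "f g = 0"
    and f: "\<And>h. h \<in> C \<Longrightarrow> feasible_direction P x h \<Longrightarrow> 0 \<le> f h"
    and parallel: "\<And>h. h \<in> C \<Longrightarrow> f h = 0 \<Longrightarrow> \<exists>s. h = s *\<^sub>R g"
  obtains t where "0 < t" "x + t *\<^sub>R g \<in> vertices P" "edge_between P x (x + t *\<^sub>R g)"
    "\<not> feasible_direction P (x + t *\<^sub>R g) g"
proof -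
  interpret f: linear f by fact
  have x: "x \<in> P" "x extreme_point_of P"
    using assms(2) by (auto simp: vertices_def extreme_point_of_def)
  have g: "g \<noteq> 0" using assms(3) zero_notin by metis
  obtain t where t: "t > 0" "x + t *\<^sub>R g \<in> P" and max: "\<And>s. s > t \<Longrightarrow> x + s *\<^sub>R g \<notin> P"
    using max_step x assms by meson
  define y where "y = x + t *\<^sub>R g"
  have backward: "0 \<le> s" if "x + s *\<^sub>R g \<in> P" for s
  proof (rule ccontr)
    assume "\<not> 0 \<le> s"
    then have s: "s < 0" by simp
    have "x \<in> open_segment (x + s *\<^sub>R g) (x + t *\<^sub>R g)"
      unfolding in_segment
    \<comment> \<open>This weight is the solution \<open>u\<close> of
      \<open>(1 - u) * s + u * t = 0\<close>, which brings the combination back to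
      \<open>x\<close>.\<close>
    proof (intro conjI exI[of _ "- s / (t - s)"])
      show "x + s *\<^sub>R g \<noteq> x + t *\<^sub>R g" using s t g by auto
      show "0 < - s / (t - s)" "- s / (t - s) < 1"
        using s t by (auto simp: divide_simps)
      have "(1 - (- s / (t - s))) * s + (- s / (t - s)) * t = 0"
        using s t by (simp add: field_simps)
      moreover have "(1 - u) *\<^sub>R (x + s *\<^sub>R g) + u *\<^sub>R (x + t *\<^sub>R g) = x + ((1 - u) * s + u * t) *\<^sub>R g" for u
        by (simp add: algebra_simps)
      ultimately show "x = (1 - (- s / (t - s))) *\<^sub>R (x + s *\<^sub>R g) + (- s / (t - s)) *\<^sub>R (x + t *\<^sub>R g)"
        by (metis add.right_neutral scaleR_zero_left)
    qed
    then show False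
      using x that t by (auto simp: extreme_point_of_def)
  qed
  have ray: "\<exists>s. z = x + s *\<^sub>R g" if z: "z \<in> P" "f z = f x" for z
  proof -
    obtain r where r: "\<And>h. h \<in> C \<Longrightarrow> 0 \<le> r h \<and> (r h \<noteq> 0 \<longrightarrow> feasible_direction P x h)"
      "z = x + (\<Sum>h\<in>C. r h *\<^sub>R h)"
      using conic x z by metis
    \<comment> \<open>These terms sum to \<open>f z - f x = 0\<close>, so each vanishes, and only
      multiples of \<open>g\<close> survive in the displacement.\<close>
    have nonneg: "0 \<le> r h * f h" if "h \<in> C" for h
      using r(1)[OF that] f[OF that] by (cases "r h = 0") auto
    have "(\<Sum>h\<in>C. r h * f h) = 0"
      using z r(2) by (simp add: f.add f.sum f.scale)
    then have "\<forall>h\<in>C. r h * f h = 0"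
      using nonneg by (subst (asm) sum_nonneg_eq_0_iff) (auto simp: finite)
    then have "\<forall>h\<in>C. \<exists>s. r h *\<^sub>R h = s *\<^sub>R g"
      using parallel by (metis mult_eq_0_iff scaleR_scaleR scaleR_zero_left)
    then obtain s where "\<forall>h\<in>C. r h *\<^sub>R h = s h *\<^sub>R g"
      by metis
    then have "z = x + (\<Sum>h\<in>C. s h) *\<^sub>R g"
      using r(2) by (simp add: scaleR_sum_left)
    then show ?thesis by blast
  qed
  have seg: "closed_segment x y = (\<lambda>s. x + s *\<^sub>R g) ` {0..t}"
  proof -
    have "closed_segment x y = (\<lambda>u. x + (t * u) *\<^sub>R g) ` {0..1}"
      unfolding y_def closed_segment_image_interval by (simp add: algebra_simps)
    also have "\<dots> = (\<lambda>s. x + s *\<^sub>R g) ` (\<lambda>u. t * u) ` {0..1}"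
      by (simp add: image_image)
    also have "(\<lambda>u. t * u) ` {0..1} = {0..t}"
      using t image_mult_atLeastAtMost[of t 0 1] by simp
    finally show ?thesis .
  qed
  have "{z \<in> P. f z = f x} = closed_segment x y"
  proof (intro equalityI subsetI)
    fix z assume "z \<in> {z \<in> P. f z = f x}"
    then obtain s where s: "z = x + s *\<^sub>R g" "z \<in> P"
      using ray by blast
    then have "s \<in> {0..t}"
      using backward max by (metis atLeastAtMost_iff not_less)
    then show "z \<in> closed_segment x y"
      using s seg by blast
  next
    fix z assume z: "z \<in> closed_segment x y"
    then have "z \<in> P"
      using x t convex y_def by (metis convex_contains_segment subsetD)
    with z show "z \<in> {z \<in> P. f z = f x}"
      using assms(5) unfolding seg by (auto simp: f.add f.scale)
  qed
  moreover have "{z \<in> P. f z = f x} face_of P"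
    using convex assms(1) x f by (intro min_face_of minimal_if_feasible_directions)
  ultimately have face: "closed_segment x y face_of P" by simp
  show thesis
  proof (rule that[OF t(1)])
    show "x + t *\<^sub>R g \<in> vertices P"
      using extreme_point_of_face[OF face] extreme_point_of_closed_segment_right
      by (auto simp: vertices_def y_def)
    show "edge_between P x (x + t *\<^sub>R g)"
      using face t g by (simp add: edge_between_def y_def)
    show "\<not> feasible_direction P (x + t *\<^sub>R g) g"
    proof
      assume "feasible_direction P (x + t *\<^sub>R g) g"
      then obtain s where "s > 0" "x + (t + s) *\<^sub>R g \<in> P"
        by (auto simp: feasible_direction_def algebra_simps)
      then show False using max[of "t + s"] by simp
    qed
  qed
qed

text \<open>
  The invariant says that \<open>x\<close> minimizes \<open>d + \<kappa> c\<close> and that no improving direction at \<open>x\<close> has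
  its breakpoint at or before \<open>\<kappa>\<close>; the set on the right holds the directions whose
  breakpoint \<open>- d g / c g\<close> is still to come.
\<close>

lemma monotone_path:
  fixes c d :: "'a \<Rightarrow> real"
  assumes lin: "linear c" "linear d"
    and generic: "\<And>g h. g \<in> C \<Longrightarrow> h \<in> C \<Longrightarrow> c g < 0 \<Longrightarrow> d h * c g = d g * c h \<Longrightarrow> \<exists>s. h = s *\<^sub>R g"
    and x: "x \<in> vertices P"
    and min: "\<And>g. g \<in> C \<Longrightarrow> feasible_direction P x g \<Longrightarrow> 0 \<le> d g + \<kappa> * c g"
    and strict: "\<And>g. g \<in> C \<Longrightarrow> feasible_direction P x g \<Longrightarrow> c g < 0 \<Longrightarrow> 0 < d g + \<kappa> * c g"
  shows "\<exists>l w. optimal_vertex P c w \<and> (x, w) \<in> directed_edges P c ^^ l \<and>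
    l \<le> card {g \<in> C. c g < 0 \<and> 0 < d g + \<kappa> * c g}"
  using x min strict
\<comment> \<open>The number of breakpoints still to come serves both as induction measure and as
  bound on the path length.\<close>
proof (induction "card {g \<in> C. c g < 0 \<and> 0 < d g + \<kappa> * c g}" arbitrary: x \<kappa> rule: less_induct)
  case (less \<kappa> x)
  interpret c: linear c by fact
  interpret d: linear d by fact
  have x: "x \<in> P" using less.prems by (auto simp: vertices_def extreme_point_of_def)
  define A where "A = {g \<in> C. feasible_direction P x g \<and> c g < 0}"
  show ?case
  proof (cases "A = {}")
    case True
    then have "0 \<le> c g" if "g \<in> C" "feasible_direction P x g" for g
      using that by (auto simp: A_def not_less)
    then have "optimal_vertex P c x"
      using less.prems(1) minimal_if_feasible_directions[OF lin(1) x]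
      by (auto simp: optimal_vertex_def)
    then show ?thesis
      by (intro exI[of _ 0] exI[of _ x]) simp
  next
    case False
    have "finite A" using finite by (simp add: A_def)
    \<comment> \<open>The parameter at which \<open>d + \<kappa> c\<close> vanishes on
      \<open>g\<close>. The least such value over \<open>A\<close> is the next breakpoint.\<close>
    define r where "r g = d g / (- c g)" for g
    obtain g where g: "g \<in> A" and g_min: "\<And>h. h \<in> A \<Longrightarrow> r g \<le> r h"
      using arg_min_least[OF \<open>finite A\<close> False] arg_min_if_finite(1)[OF \<open>finite A\<close> False] by metis
    define \<mu> where "\<mu> = r g"
    define f where "f z = d z + \<mu> * c z" for z
    have gC: "g \<in> C" "feasible_direction P x g" "c g < 0"
      using g by (auto simp: A_def)
    have lin_f: "linear f"
      unfolding f_def by (intro linearI) (auto simp: c.add d.add c.scale d.scale algebra_simps)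
    have fg: "f g = 0"
      using gC by (simp add: f_def \<mu>_def r_def)
    have "\<kappa> < \<mu>"
      using less.prems(3)[OF gC] gC(3) by (simp add: \<mu>_def r_def field_simps)
    \<comment> \<open>Improving directions are handled by the minimality of \<open>\<mu>\<close>; on
      the others, raising the parameter from \<open>\<kappa>\<close> to \<open>\<mu>\<close> cannot
      lower the value.\<close>
    have f_nonneg: "0 \<le> f h" if h: "h \<in> C" "feasible_direction P x h" for h
    proof (cases "c h < 0")
      case True
      then have "\<mu> \<le> r h" using h g_min by (simp add: A_def \<mu>_def)
      then show ?thesis using True by (simp add: f_def r_def field_simps)
    next
      case False
      then have "\<kappa> * c h \<le> \<mu> * c h"
        using \<open>\<kappa> < \<mu>\<close> by (intro mult_right_mono) auto
      then show ?thesis using less.prems(2)[OF h] by (simp add: f_def)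
    qed
    have parallel: "\<exists>s. h = s *\<^sub>R g" if h: "h \<in> C" "f h = 0" for h
    proof (rule generic[OF gC(1) h(1) gC(3)])
      show "d h * c g = d g * c h"
        using h(2) gC(3) by (simp add: f_def \<mu>_def r_def field_simps)
    qed
    obtain t where t: "0 < t" "x + t *\<^sub>R g \<in> vertices P" "edge_between P x (x + t *\<^sub>R g)"
      "\<not> feasible_direction P (x + t *\<^sub>R g) g"
      using edge_of_minimizers[OF lin_f less.prems(1) gC(1,2) fg f_nonneg parallel] by metis
    define y where "y = x + t *\<^sub>R g"
    interpret f: linear f by (fact lin_f)
    have fy: "f y = f x" by (simp add: y_def f.add f.scale fg)
    \<comment> \<open>Moving along \<open>g\<close> keeps the value of \<open>f\<close>, so
      \<open>y\<close> minimizes \<open>f\<close> as well.\<close>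
    have f_nonneg': "0 \<le> f h" if h: "h \<in> C" "feasible_direction P y h" for h
    proof -
      obtain s where s: "s > 0" "y + s *\<^sub>R h \<in> P"
        using h by (auto simp: feasible_direction_def)
      have "f x \<le> f (y + s *\<^sub>R h)"
        using minimal_if_feasible_directions[OF lin_f x s(2) f_nonneg] .
      then have "0 \<le> s * f h" by (simp add: f.add f.scale fy)
      then show ?thesis using s by (simp add: zero_le_mult_iff)
    qed
    \<comment> \<open>Otherwise \<open>h\<close> would be a positive multiple of \<open>g\<close>,
      but the maximal step has exhausted \<open>g\<close> at \<open>y\<close>.\<close>
    have f_pos': "0 < f h" if h: "h \<in> C" "feasible_direction P y h" "c h < 0" for h
    proof (rule ccontr)
      assume "\<not> 0 < f h"
      then have "f h = 0" using f_nonneg'[OF h(1,2)] by simp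
      then obtain s where s: "h = s *\<^sub>R g" using parallel h by blast
      then have "s > 0" using h(3) gC(3) by (auto simp: c.scale mult_less_0_iff)
      obtain u where "u > 0" "y + u *\<^sub>R h \<in> P"
        using h(2) by (auto simp: feasible_direction_def)
      then have "feasible_direction P y g"
        unfolding feasible_direction_def using s \<open>s > 0\<close>
        by (intro exI[of _ "u * s"]) simp
      then show False using t(4) y_def by simp
    qed
    let ?B = "\<lambda>\<kappa>. {g \<in> C. c g < 0 \<and> 0 < d g + \<kappa> * c g}"
    have "?B \<mu> \<subseteq> ?B \<kappa>"
    proof
      fix h assume h: "h \<in> ?B \<mu>"
      then have "\<mu> * c h \<le> \<kappa> * c h"
        using \<open>\<kappa> < \<mu>\<close> by (intro mult_right_mono_neg) auto
      then have "d h + \<mu> * c h \<le> d h + \<kappa> * c h" by (rule add_left_mono)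
      with h show "h \<in> ?B \<kappa>" unfolding mem_Collect_eq by (meson less_le_trans)
    qed
    \<comment> \<open>The breakpoint of \<open>g\<close> is \<open>\<mu>\<close> itself, so
      \<open>g\<close> leaves the set and the measure drops.\<close>
    moreover have "g \<in> ?B \<kappa>" "g \<notin> ?B \<mu>"
      using gC less.prems(3) fg by (auto simp: f_def)
    ultimately have card: "card (?B \<mu>) < card (?B \<kappa>)"
      using finite by (intro psubset_card_mono) auto
    obtain l w where l: "optimal_vertex P c w" "(y, w) \<in> directed_edges P c ^^ l" "l \<le> card (?B \<mu>)"
      using less.hyps[OF card t(2)[folded y_def] f_nonneg'[unfolded f_def] f_pos'[unfolded f_def]]
      by blast
    have "(x, y) \<in> directed_edges P c"
      using less.prems(1) t gC(3) by (simp add: directed_edges_def y_def c.add c.scale mult_pos_neg)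
    then have "(x, w) \<in> directed_edges P c ^^ Suc l"
      using l(2) by (rule relpow_Suc_I2)
    then show ?thesis
      using l card by (intro exI[of _ "Suc l"] exI[of _ w]) auto
  qed
qed

text \<open>The path starts at parameter \<open>0\<close>, where every feasible direction at
  \<open>v\<close> strictly increases \<open>d\<close>; its breakpoints belong to distinct members
  of \<open>C\<close>.\<close>

lemma monotone_distance_le_card:
  fixes c d :: "'a \<Rightarrow> real"
  assumes "linear c" "linear d" "v \<in> vertices P"
    and "\<And>g h. g \<in> C \<Longrightarrow> h \<in> C \<Longrightarrow> c g < 0 \<Longrightarrow> d h * c g = d g * c h \<Longrightarrow> \<exists>s. h = s *\<^sub>R g"
    and "\<And>g. g \<in> C \<Longrightarrow> feasible_direction P v g \<Longrightarrow> 0 < d g"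
  shows "monotone_distance P c v \<le> enat (card C)"
proof -
  have "\<exists>l w. optimal_vertex P c w \<and> (v, w) \<in> directed_edges P c ^^ l \<and>
      l \<le> card {g \<in> C. c g < 0 \<and> 0 < d g + 0 * c g}"
  proof (rule monotone_path[OF assms(1,2) _ assms(3)])
    show "\<exists>s. h = s *\<^sub>R g" if "g \<in> C" "h \<in> C" "c g < 0" "d h * c g = d g * c h" for g h
      using that by (rule assms(4))
  qed (use assms(5) in \<open>auto intro: less_imp_le\<close>)
  then obtain l w where l: "optimal_vertex P c w" "(v, w) \<in> directed_edges P c ^^ l"
    "l \<le> card {g \<in> C. c g < 0 \<and> 0 < d g + 0 * c g}"
    by blast
  have "l \<le> card C"
    using l(3) by (rule order_trans) (intro card_mono finite, auto)
  have "monotone_distance P c v \<le> enat l"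
    unfolding monotone_distance_def using l by (intro Inf_lower) auto
  also have "\<dots> \<le> enat (card C)" using \<open>l \<le> card C\<close> by simp
  finally show ?thesis .
qed

end

subsection \<open>Alternating cycles\<close>

abbreviation entry :: "matrix \<Rightarrow> nat \<times> nat \<Rightarrow> real" where
  "entry \<equiv> Poly_Mapping.lookup"

lemma lookup_scaleR [simp]:
  "Poly_Mapping.lookup (r *\<^sub>R x) p = r *\<^sub>R Poly_Mapping.lookup x p"
proof -
  have "finite {i. r *\<^sub>R Poly_Mapping.lookup x i \<noteq> 0}"
    by (rule finite_subset[OF _ finite_lookup[of x]]) auto
  then show ?thesis by (simp add: scaleR_poly_mapping_def)
qed

section \<open>Matrices with zero row and column sums\<close>

lemma sum_eq_0_signs:
  fixes f :: "'a \<Rightarrow> real"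
  assumes "finite A" "sum f A = 0" "a \<in> A" "f a \<noteq> 0"
  shows "\<exists>b\<in>A. 0 < f b" and "\<exists>b\<in>A. f b < 0"
proof -
  have *: "\<exists>b\<in>A. h b < 0" if "sum h A = 0" "h a \<noteq> 0" for h :: "'a \<Rightarrow> real"
  proof (rule ccontr)
    assume "\<not> (\<exists>b\<in>A. h b < 0)"
    then have "\<forall>b\<in>A. h b = 0"
      using sum_nonneg_eq_0_iff[OF assms(1), of h] that(1) by (simp add: not_less)
    then show False using that(2) assms(3) by blast
  qed
  show "\<exists>b\<in>A. 0 < f b"
    using *[of "\<lambda>b. - f b"] assms(2,4) by (simp add: sum_negf)
  show "\<exists>b\<in>A. f b < 0"
    using * assms(2,4) .
qed

text \<open>The linear space parallel to the equations of a transportation polytope, whatever the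
  supplies and demands.\<close>

definition balanced :: "nat \<Rightarrow> nat \<Rightarrow> matrix set" where
  "balanced k n = {y. Poly_Mapping.keys y \<subseteq> {..<k} \<times> {..<n} \<and>
     (\<forall>i<k. (\<Sum>j<n. entry y (i, j)) = 0) \<and> (\<forall>j<n. (\<Sum>i<k. entry y (i, j)) = 0)}"

lemma balanced_entry_bounds:
  assumes "y \<in> balanced k n" "entry y (i, j) \<noteq> 0"
  shows "i < k" "j < n"
  using assms by (auto simp: balanced_def subset_iff in_keys_iff)

lemma balanced_row_signs:
  assumes "y \<in> balanced k n" "entry y (i, j) \<noteq> 0"
  shows "\<exists>j'<n. 0 < entry y (i, j')" and "\<exists>j'<n. entry y (i, j') < 0"
proof -
  have ij: "i < k" "j < n" using balanced_entry_bounds[OF assms] .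
  then have "(\<Sum>j<n. entry y (i, j)) = 0" using assms by (simp add: balanced_def)
  from sum_eq_0_signs[OF _ this, of j] ij assms(2)
  show "\<exists>j'<n. 0 < entry y (i, j')" "\<exists>j'<n. entry y (i, j') < 0" by auto
qed

lemma balanced_column_signs:
  assumes "y \<in> balanced k n" "entry y (i, j) \<noteq> 0"
  shows "\<exists>i'<k. 0 < entry y (i', j)" and "\<exists>i'<k. entry y (i', j) < 0"
proof -
  have ij: "i < k" "j < n" using balanced_entry_bounds[OF assms] .
  then have "(\<Sum>i<k. entry y (i, j)) = 0" using assms by (simp add: balanced_def)
  from sum_eq_0_signs[OF _ this, of i] ij assms(2)
  show "\<exists>i'<k. 0 < entry y (i', j)" "\<exists>i'<k. entry y (i', j) < 0" by auto
qed

lemma balanced_diff_scaleR: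
  assumes "y \<in> balanced k n" "g \<in> balanced k n"
  shows "y - r *\<^sub>R g \<in> balanced k n"
  using assms
  by (auto simp: balanced_def lookup_minus sum_subtractf subset_iff in_keys_iff simp flip: sum_distrib_left)
    (metis mult_zero_right)+

text \<open>
  A cycle visits the rows of \<open>S\<close>, entering each row \<open>i\<close> from row \<open>\<tau> i\<close> through column \<open>J (\<tau> i)\<close>
  and leaving it through column \<open>J i\<close>. Neither cyclicity of \<open>\<tau>\<close> nor injectivity of \<open>J\<close> is
  imposed: the larger set of matrices still meets the required bound.
\<close>

definition cycle_entry :: "nat set \<Rightarrow> (nat \<Rightarrow> nat) \<Rightarrow> (nat \<Rightarrow> nat) \<Rightarrow> nat \<times> nat \<Rightarrow> real" where
  "cycle_entry S \<tau> J = (\<lambda>(i, j). if i \<in> S then of_bool (j = J i) - of_bool (j = J (\<tau> i)) else 0)"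

definition cycle_matrix :: "nat set \<Rightarrow> (nat \<Rightarrow> nat) \<Rightarrow> (nat \<Rightarrow> nat) \<Rightarrow> matrix" where
  "cycle_matrix S \<tau> J = Abs_poly_mapping (cycle_entry S \<tau> J)"

text \<open>Extensional functions \<open>J\<close> make the choices finite: there are
  \<open>fact l * n ^ l\<close> of them for each \<open>S\<close> with \<open>l\<close>
  elements.\<close>

definition cycle_data :: "nat \<Rightarrow> nat \<Rightarrow> (nat set \<times> (nat \<Rightarrow> nat) \<times> (nat \<Rightarrow> nat)) set" where
  "cycle_data k n = (SIGMA S : Pow {..<k}. {\<tau>. \<tau> permutes S} \<times> (S \<rightarrow>\<^sub>E {..<n}))"

text \<open>Some data, such as \<open>S = {}\<close>, give the zero matrix, which is not a
  direction.\<close>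

definition cycle_matrices :: "nat \<Rightarrow> nat \<Rightarrow> matrix set" where
  "cycle_matrices k n = (\<lambda>(S, \<tau>, J). cycle_matrix S \<tau> J) ` cycle_data k n - {0}"

lemma entry_cycle_matrix:
  assumes "(S, \<tau>, J) \<in> cycle_data k n"
  shows "entry (cycle_matrix S \<tau> J) = cycle_entry S \<tau> J"
proof -
  have "{p. cycle_entry S \<tau> J p \<noteq> 0} \<subseteq> {..<k} \<times> {..<n}"
    using assms
    by (auto simp: cycle_data_def cycle_entry_def permutes_in_image PiE_iff of_bool_def split: if_splits)
  then have "finite {p. cycle_entry S \<tau> J p \<noteq> 0}"
    by (rule finite_subset) simp
  then show ?thesis by (simp add: cycle_matrix_def)
qed

text \<open>A row in \<open>S\<close> receives one \<open>+1\<close> and one \<open>-1\<close>. In a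
  column, the counts over \<open>J i\<close> and over \<open>J (\<tau> i)\<close> agree because
  \<open>\<tau>\<close> permutes \<open>S\<close>.\<close>

lemma cycle_matrix_balanced:
  assumes "(S, \<tau>, J) \<in> cycle_data k n"
  shows "cycle_matrix S \<tau> J \<in> balanced k n"
proof -
  have S: "S \<subseteq> {..<k}" "\<tau> permutes S" and J: "\<And>i. i \<in> S \<Longrightarrow> J i < n"
    using assms by (auto simp: cycle_data_def)
  have J': "J (\<tau> i) < n" if "i \<in> S" for i
    using J that S(2) by (simp add: permutes_in_image)
  have "(\<Sum>j<n. cycle_entry S \<tau> J (i, j)) = 0" for i
    using J[of i] J'[of i] by (cases "i \<in> S") (simp_all add: cycle_entry_def sum_subtractf of_bool_def)
  moreover have "(\<Sum>i<k. cycle_entry S \<tau> J (i, j)) = 0" for j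
  proof -
    have "(\<Sum>i<k. cycle_entry S \<tau> J (i, j)) =
        (\<Sum>i\<in>S. of_bool (j = J i)) - (\<Sum>i\<in>S. of_bool (j = J (\<tau> i)))"
      unfolding cycle_entry_def sum_subtractf[symmetric] prod.case
      using S(1) by (intro sum.mono_neutral_cong_right) auto
    also have "(\<Sum>i\<in>S. of_bool (j = J (\<tau> i))) = (\<Sum>i\<in>S. of_bool (j = J i) :: real)"
      using sum.permute[OF S(2), of "\<lambda>i. of_bool (j = J i) :: real"] by (simp add: comp_def)
    finally show ?thesis by simp
  qed
  moreover have "Poly_Mapping.keys (cycle_matrix S \<tau> J) \<subseteq> {..<k} \<times> {..<n}"
    using S(1) J J'
    by (auto simp: in_keys_iff entry_cycle_matrix[OF assms] cycle_entry_def of_bool_def split: if_splits)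
  ultimately show ?thesis
    by (simp add: balanced_def entry_cycle_matrix[OF assms])
qed

lemma cycle_matrices_balanced: "g \<in> cycle_matrices k n \<Longrightarrow> g \<in> balanced k n"
  by (auto simp: cycle_matrices_def cycle_matrix_balanced)

section \<open>Counting the cycle matrices\<close>

lemma finite_cycle_data: "finite (cycle_data k n)"
  unfolding cycle_data_def
  by (intro finite_SigmaI finite_cartesian_product finite_permutations finite_PiE)
    (auto intro: finite_subset)

lemma finite_cycle_matrices: "finite (cycle_matrices k n)"
  by (simp add: cycle_matrices_def finite_cycle_data)

lemma sum_Pow_card:
  fixes f :: "nat \<Rightarrow> 'b::comm_semiring_1"
  assumes "finite A"
  shows "(\<Sum>S\<in>Pow A. f (card S)) = (\<Sum>l\<le>card A. of_nat (card A choose l) * f l)"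
proof -
  have "(\<Sum>S\<in>Pow A. f (card S)) = (\<Sum>l\<le>card A. \<Sum>S\<in>{S \<in> Pow A. card S = l}. f (card S))"
    using assms by (intro sum.group[symmetric]) (auto intro: card_mono)
  also have "\<dots> = (\<Sum>l\<le>card A. of_nat (card A choose l) * f l)"
  proof (rule sum.cong)
    fix l
    have "(\<Sum>S\<in>{S \<in> Pow A. card S = l}. f (card S)) = (\<Sum>S\<in>{S. S \<subseteq> A \<and> card S = l}. f l)"
      by (intro sum.cong) auto
    then show "(\<Sum>S\<in>{S \<in> Pow A. card S = l}. f (card S)) = of_nat (card A choose l) * f l"
      using n_subsets[OF assms] by simp
  qed simp
  finally show ?thesis .
qed

lemma card_cycle_data: "card (cycle_data k n) = (\<Sum>l\<le>k. (k choose l) * (fact l * n ^ l))"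
proof -
  have fin: "finite S" if "S \<subseteq> {..<k}" for S using that finite_subset by blast
  have "card (cycle_data k n) = (\<Sum>S\<in>Pow {..<k}. fact (card S) * n ^ card S)"
    unfolding cycle_data_def
    using fin by (subst card_SigmaI)
      (auto simp: finite_permutations finite_PiE card_cartesian_product card_permutations card_PiE intro!: sum.cong)
  then show ?thesis
    using sum_Pow_card[of "{..<k}" "\<lambda>l. fact l * n ^ l"] by simp
qed

lemma sum_inverse_fact_le_exp: "(\<Sum>l\<le>k. 1 / fact l) \<le> exp (1::real)"
proof -
  have "(\<Sum>l\<le>k. 1 / fact l) \<le> (suminf (\<lambda>l. (1::real) ^ l /\<^sub>R fact l))"
    using sum_le_suminf[OF summable_exp_generic[of "1::real"], of "{..k}"]
    by (simp add: divide_inverse)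
  then show ?thesis by (simp add: exp_def)
qed

text \<open>With \<open>(k choose l) * fact l = fact k / fact (k - l)\<close> and
  \<open>n ^ l \<le> n ^ k\<close>, the count is at most \<open>fact k * n ^ k\<close> times a
  partial sum of the series for \<open>exp 1\<close>.\<close>

lemma card_cycle_matrices:
  assumes "0 < n \<or> k = 0"
  shows "real (card (cycle_matrices k n)) \<le> exp 1 * fact k * real n ^ k"
proof -
  have "card (cycle_matrices k n) \<le> card (cycle_data k n)"
    unfolding cycle_matrices_def
    by (intro order_trans[OF card_Diff1_le] card_image_le finite_cycle_data)
  also have "real \<dots> = (\<Sum>l\<le>k. real (k choose l) * (fact l * real n ^ l))"
    by (simp add: card_cycle_data)
  also have "\<dots> \<le> (\<Sum>l\<le>k. 1 / fact (k - l) * (fact k * real n ^ k))"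
  proof (rule sum_mono)
    fix l assume l: "l \<in> {..k}"
    \<comment> \<open>For \<open>n = 0\<close> this would fail at \<open>l = 0 < k\<close>, the case
      that the assumption excludes.\<close>
    have "real n ^ l \<le> real n ^ k"
      using assms l by (auto intro: power_increasing)
    then have "fact k / fact (k - l) * real n ^ l \<le> fact k / fact (k - l) * real n ^ k"
      by (intro mult_left_mono) auto
    then show "real (k choose l) * (fact l * real n ^ l) \<le> 1 / fact (k - l) * (fact k * real n ^ k)"
      using l by (simp add: binomial_fact field_simps)
  qed
  also have "\<dots> = (\<Sum>l\<le>k. 1 / fact (k - l)) * (fact k * real n ^ k)"
    by (rule sum_distrib_right[symmetric])
  also have "(\<Sum>l\<le>k. 1 / fact (k - l)) = (\<Sum>l\<le>k. 1 / fact l :: real)"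
    using sum.nat_diff_reindex[of "\<lambda>l. 1 / fact l :: real" "Suc k"]
    by (simp add: lessThan_Suc_atMost)
  also have "\<dots> * (fact k * real n ^ k) \<le> exp 1 * (fact k * real n ^ k)"
    by (intro mult_right_mono sum_inverse_fact_le_exp) simp
  finally show ?thesis by (simp add: mult.assoc)
qed

section \<open>Sign-conformal decomposition into cycles\<close>

definition conformal :: "matrix \<Rightarrow> matrix \<Rightarrow> bool" where
  "conformal g y \<longleftrightarrow> (\<forall>p. (0 < entry g p \<longrightarrow> 0 < entry y p) \<and> (entry g p < 0 \<longrightarrow> entry y p < 0))"

text \<open>Replacing \<open>R\<close> by its image shrinks it until \<open>f\<close> is onto, and a
  surjective self-map of a finite set is bijective.\<close>

lemma finite_self_map_cycle:
  assumes "finite R" "R \<noteq> {}" "f ` R \<subseteq> R"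
  obtains S where "S \<noteq> {}" "S \<subseteq> R" "bij_betw f S S"
  using assms
proof (induction "card R" arbitrary: R thesis rule: less_induct)
  case less
  show ?case
  proof (cases "f ` R = R")
    case True
    then show ?thesis
      using less.prems finite_surj_inj[of R f] by (auto simp: bij_betw_def)
  next
    case False
    then have "card (f ` R) < card R"
      using less.prems by (intro psubset_card_mono) auto
    then show ?thesis
      using less.hyps[of "f ` R"] less.prems by (metis finite_imageI image_is_empty image_mono subset_trans)
  qed
qed

text \<open>Walk through the support: from row \<open>i\<close> to a positive entry in column
  \<open>J i\<close>, then down that column to a negative entry in row \<open>f i\<close>. Where
  \<open>f\<close> is bijective, these entries carry a cycle.\<close>

lemma conformal_cycle:
  assumes y: "y \<in> balanced k n" "y \<noteq> 0"
  shows "\<exists>g\<in>cycle_matrices k n. conformal g y"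
proof -
  define R where "R = {i. \<exists>j. entry y (i, j) \<noteq> 0}"
  have "R \<subseteq> {..<k}" using balanced_entry_bounds[OF y(1)] by (auto simp: R_def)
  then have "finite R" by (rule finite_subset) simp
  have "R \<noteq> {}"
    using y(2) by (auto simp: R_def poly_mapping_eq_iff fun_eq_iff)
  have "\<forall>i\<in>R. \<exists>j. 0 < entry y (i, j)"
    using balanced_row_signs(1)[OF y(1)] by (auto simp: R_def)
  then obtain J where J: "\<And>i. i \<in> R \<Longrightarrow> 0 < entry y (i, J i)" by metis
  have "\<forall>i\<in>R. \<exists>i'. entry y (i', J i) < 0"
    using balanced_column_signs(2)[OF y(1)] J by (metis less_irrefl)
  then obtain f where f: "\<And>i. i \<in> R \<Longrightarrow> entry y (f i, J i) < 0" by metis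
  have "f ` R \<subseteq> R" using f unfolding R_def by (metis (mono_tags, lifting) image_subsetI less_irrefl mem_Collect_eq)
  then obtain S where S: "S \<noteq> {}" "S \<subseteq> R" "bij_betw f S S"
    using finite_self_map_cycle[OF \<open>finite R\<close> \<open>R \<noteq> {}\<close>] by metis
  \<comment> \<open>Extended by the identity as \<open>permutes\<close> demands; its inverse sends
    each row of \<open>S\<close> to the row from which it is entered.\<close>
  define \<sigma> where "\<sigma> i = (if i \<in> S then f i else i)" for i
  have "bij_betw \<sigma> S S"
    using S(3) by (simp add: \<sigma>_def cong: bij_betw_cong)
  then have \<sigma>: "\<sigma> permutes S"
    by (rule bij_imp_permutes) (simp add: \<sigma>_def)
  let ?\<tau> = "inv \<sigma>" and ?J = "restrict J S"
  have \<tau>: "?\<tau> permutes S" using \<sigma> by (rule permutes_inv)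
  have \<tau>S: "?\<tau> i \<in> S" if "i \<in> S" for i
    using \<tau> that by (simp add: permutes_in_image)
  have pos: "0 < entry y (i, J i)" and neg: "entry y (i, J (?\<tau> i)) < 0" if "i \<in> S" for i
  proof -
    show "0 < entry y (i, J i)" using J that S(2) by blast
    have "f (?\<tau> i) = \<sigma> (?\<tau> i)" using \<tau>S[OF that] by (simp add: \<sigma>_def)
    also have "\<dots> = i" using \<sigma> by (rule permutes_inverses(1))
    finally show "entry y (i, J (?\<tau> i)) < 0"
      using f[of "?\<tau> i"] \<tau>S[OF that] S(2) by auto
  qed
  have "J i < n" if "i \<in> S" for i
    using balanced_entry_bounds(2)[OF y(1)] pos[OF that] by (metis less_irrefl)
  then have data: "(S, ?\<tau>, ?J) \<in> cycle_data k n"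
    using \<tau> S(2) \<open>R \<subseteq> {..<k}\<close> by (auto simp: cycle_data_def)
  note e = entry_cycle_matrix[OF data]
  have "conformal (cycle_matrix S ?\<tau> ?J) y"
    using pos neg \<tau>S unfolding conformal_def e
    by (auto simp: cycle_entry_def of_bool_def split: if_splits)
  moreover have "cycle_matrix S ?\<tau> ?J \<noteq> 0"
  proof -
    obtain i where i: "i \<in> S" using S(1) by blast
    then have "J i \<noteq> J (?\<tau> i)" using pos[OF i] neg[OF i] by auto
    then have "entry (cycle_matrix S ?\<tau> ?J) (i, J i) = 1"
      using i \<tau>S[OF i] unfolding e by (simp add: cycle_entry_def)
    then show ?thesis by auto
  qed
  ultimately show ?thesis
    using data by (force simp: cycle_matrices_def)
qed

text \<open>Peel off a conformal cycle, scaled by the smallest ratio of entries. This kills an entry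
  and reverses no sign, so the support shrinks and cycles conformal to the rest stay conformal to
  \<open>y\<close>.\<close>

lemma conformal_decomposition:
  assumes "y \<in> balanced k n"
  shows "\<exists>t. (\<forall>g\<in>cycle_matrices k n. 0 \<le> t g \<and> (t g \<noteq> 0 \<longrightarrow> conformal g y)) \<and>
    y = (\<Sum>g\<in>cycle_matrices k n. t g *\<^sub>R g)"
  using assms
proof (induction "card (Poly_Mapping.keys y)" arbitrary: y rule: less_induct)
  case less
  show ?case
  proof (cases "y = 0")
    case True
    then show ?thesis by (intro exI[of _ "\<lambda>_. 0"]) simp
  next
    case False
    obtain g where g: "g \<in> cycle_matrices k n" "conformal g y"
      using conformal_cycle less.prems False by blast
    have "g \<noteq> 0" using g by (auto simp: cycle_matrices_def)
    define r where "r = Min ((\<lambda>p. entry y p / entry g p) ` Poly_Mapping.keys g)"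
    have "r \<in> (\<lambda>p. entry y p / entry g p) ` Poly_Mapping.keys g"
      unfolding r_def using \<open>g \<noteq> 0\<close> by (intro Min_in) auto
    then obtain q where q: "q \<in> Poly_Mapping.keys g" "r = entry y q / entry g q"
      by blast
    have quot: "0 < entry y p / entry g p" if "entry g p \<noteq> 0" for p
      using g(2) that unfolding conformal_def
      by (metis divide_neg_neg divide_pos_pos linorder_neqE_linordered_idom)
    then have "0 < r" using q by (simp add: in_keys_iff)
    have r_le: "r \<le> entry y p / entry g p" if "entry g p \<noteq> 0" for p
      unfolding r_def using that by (intro Min_le) (auto simp: in_keys_iff)
    define z where "z = y - r *\<^sub>R g"
    have z: "entry z p = entry y p - r * entry g p" for p
      by (simp add: z_def lookup_minus)
    \<comment> \<open>By the choice of \<open>r\<close>, the amount \<open>r * entry g p\<close>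
      lies between \<open>0\<close> and \<open>entry y p\<close>.\<close>
    have signs: "(0 < entry z p \<longrightarrow> 0 < entry y p) \<and> (entry z p < 0 \<longrightarrow> entry y p < 0)" for p
    proof (cases "entry g p" "0 :: real" rule: linorder_cases)
      case less
      then have "entry y p < 0" using g(2) unfolding conformal_def by blast
      moreover have "entry z p \<le> 0"
        using r_le[of p] less by (simp add: z field_simps)
      ultimately show ?thesis by simp
    next
      case greater
      then have "0 < entry y p" using g(2) unfolding conformal_def by blast
      moreover have "0 \<le> entry z p"
        using r_le[of p] greater by (simp add: z field_simps)
      ultimately show ?thesis by simp
    qed (simp add: z)
    have "Poly_Mapping.keys z \<subseteq> Poly_Mapping.keys y"
    proof
      fix p assume "p \<in> Poly_Mapping.keys z"
      then show "p \<in> Poly_Mapping.keys y"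
        using signs[of p] by (auto simp: in_keys_iff)
    qed
    moreover have "q \<in> Poly_Mapping.keys y" "q \<notin> Poly_Mapping.keys z"
      using q quot[of q] by (auto simp: in_keys_iff z)
    ultimately have "card (Poly_Mapping.keys z) < card (Poly_Mapping.keys y)"
      by (intro psubset_card_mono) auto
    moreover have "z \<in> balanced k n"
      unfolding z_def using less.prems cycle_matrices_balanced[OF g(1)] by (rule balanced_diff_scaleR)
    ultimately obtain t where t: "\<forall>h\<in>cycle_matrices k n. 0 \<le> t h \<and> (t h \<noteq> 0 \<longrightarrow> conformal h z)"
      and sum: "z = (\<Sum>h\<in>cycle_matrices k n. t h *\<^sub>R h)"
      using less.hyps[of z] by blast
    have conf: "conformal h y" if "conformal h z" for h
      using that signs unfolding conformal_def by blast
    define u where "u = t(g := t g + r)"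
    have "(\<Sum>h\<in>cycle_matrices k n. u h *\<^sub>R h) = r *\<^sub>R g + (\<Sum>h\<in>cycle_matrices k n. t h *\<^sub>R h)"
      using finite_cycle_matrices g(1)
      by (simp add: u_def sum.remove[of _ g] algebra_simps)
    also have "\<dots> = y" by (simp add: z_def flip: sum)
    finally show ?thesis
      using t conf g(2) \<open>0 < r\<close> by (intro exI[of _ u]) (auto simp: u_def)
  qed
qed

subsection \<open>Transportation polytopes\<close>

lemma entry_nonneg:
  assumes "x \<in> transportation_polytope k n a b"
  shows "0 \<le> entry x p"
proof (cases "p \<in> Poly_Mapping.keys x")
  case True
  then have "p \<in> {..<k} \<times> {..<n}" using assms by (auto simp: transportation_polytope_def)
  then show ?thesis using assms by (cases p) (simp add: transportation_polytope_def)
qed (simp add: in_keys_iff)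

lemma diff_balanced:
  assumes "x \<in> transportation_polytope k n a b" "z \<in> transportation_polytope k n a b"
  shows "z - x \<in> balanced k n"
proof -
  have "Poly_Mapping.keys (z - x) \<subseteq> Poly_Mapping.keys z \<union> Poly_Mapping.keys x"
    by (auto simp: in_keys_iff lookup_minus)
  then show ?thesis
    using assms
    by (auto simp: transportation_polytope_def balanced_def lookup_minus sum_subtractf)
qed

text \<open>Adding a balanced matrix preserves the row and column sums, so only signs remain to be
  checked.\<close>

lemma add_balanced_mem_iff:
  assumes "x \<in> transportation_polytope k n a b" "g \<in> balanced k n"
  shows "x + t *\<^sub>R g \<in> transportation_polytope k n a b \<longleftrightarrow> (\<forall>p. 0 \<le> entry x p + t * entry g p)"
proof
  assume "x + t *\<^sub>R g \<in> transportation_polytope k n a b"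
  then show "\<forall>p. 0 \<le> entry x p + t * entry g p"
    by (metis entry_nonneg lookup_add lookup_scaleR real_scaleR_def)
next
  assume nonneg: "\<forall>p. 0 \<le> entry x p + t * entry g p"
  have "Poly_Mapping.keys (x + t *\<^sub>R g) \<subseteq> Poly_Mapping.keys x \<union> Poly_Mapping.keys g"
    by (auto simp: in_keys_iff lookup_add)
  then show "x + t *\<^sub>R g \<in> transportation_polytope k n a b"
    using assms nonneg
    by (auto simp: transportation_polytope_def balanced_def lookup_add sum.distrib simp flip: sum_distrib_left)
qed

lemma convex_transportation_polytope: "convex (transportation_polytope k n a b)"
proof (rule convexI)
  fix x z :: matrix and u v :: real
  assume x: "x \<in> transportation_polytope k n a b" and z: "z \<in> transportation_polytope k n a b"
    and uv: "0 \<le> u" "0 \<le> v" "u + v = 1"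
  have u: "u = 1 - v" using uv by simp
  \<comment> \<open>The convex combination is the step of length \<open>v\<close> from
    \<open>x\<close> along the balanced matrix \<open>z - x\<close>.\<close>
  have "entry x p + v * entry (z - x) p = u * entry x p + v * entry z p" for p
    by (simp add: lookup_minus u algebra_simps)
  then have "\<forall>p. 0 \<le> entry x p + v * entry (z - x) p"
    using uv entry_nonneg[OF x] entry_nonneg[OF z] by simp
  then have "x + v *\<^sub>R (z - x) \<in> transportation_polytope k n a b"
    using add_balanced_mem_iff[OF x diff_balanced[OF x z]] by blast
  also have "x + v *\<^sub>R (z - x) = u *\<^sub>R x + v *\<^sub>R z"
    by (simp add: u algebra_simps)
  finally show "u *\<^sub>R x + v *\<^sub>R z \<in> transportation_polytope k n a b" .
qed

text \<open>The ratio test of the simplex method: the step ends when the first decreasing entry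
  reaches zero. A nonzero balanced matrix has a negative entry, so this happens.\<close>

lemma transportation_max_step:
  assumes x: "x \<in> transportation_polytope k n a b" and g: "g \<in> balanced k n" "g \<noteq> 0"
    and pos: "\<And>p. entry g p < 0 \<Longrightarrow> 0 < entry x p"
  shows "\<exists>t>0. x + t *\<^sub>R g \<in> transportation_polytope k n a b \<and>
    (\<forall>s>t. x + s *\<^sub>R g \<notin> transportation_polytope k n a b)"
proof -
  define N where "N = {p \<in> Poly_Mapping.keys g. entry g p < 0}"
  define t where "t = Min ((\<lambda>p. entry x p / (- entry g p)) ` N)"
  obtain i j where "entry g (i, j) \<noteq> 0"
    using g(2) by (auto simp: poly_mapping_eq_iff fun_eq_iff)
  then obtain j' where "entry g (i, j') < 0"
    using balanced_row_signs(2)[OF g(1)] by blast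
  then have "(i, j') \<in> N" by (simp add: N_def in_keys_iff)
  then have "N \<noteq> {}" by blast
  have "finite N" by (simp add: N_def)
  have "t \<in> (\<lambda>p. entry x p / (- entry g p)) ` N"
    unfolding t_def using \<open>N \<noteq> {}\<close> \<open>finite N\<close> by (intro Min_in) auto
  then obtain q where q: "entry g q < 0" "t = entry x q / (- entry g q)"
    by (auto simp: N_def)
  have "0 < t" unfolding q(2) using q(1) pos[OF q(1)] by (intro divide_pos_pos) auto
  have "0 \<le> entry x p + t * entry g p" for p
  proof (cases "entry g p < 0")
    case True
    then have "t \<le> entry x p / (- entry g p)"
      unfolding t_def using \<open>finite N\<close> by (intro Min_le) (auto simp: N_def in_keys_iff)
    then show ?thesis using True by (simp add: field_simps)
  next
    case False
    then show ?thesis using entry_nonneg[OF x, of p] \<open>0 < t\<close> by simp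
  qed
  moreover have "entry x q + s * entry g q < 0" if "s > t" for s
    using that q by (simp add: field_simps)
  ultimately show ?thesis
    using \<open>0 < t\<close> unfolding add_balanced_mem_iff[OF x g(1)] by (meson not_le)
qed

lemma transportation_feasible_direction_iff:
  assumes x: "x \<in> transportation_polytope k n a b" and g: "g \<in> balanced k n"
  shows "feasible_direction (transportation_polytope k n a b) x g \<longleftrightarrow>
    (\<forall>p. entry g p < 0 \<longrightarrow> 0 < entry x p)"
proof
  assume "feasible_direction (transportation_polytope k n a b) x g"
  then obtain t where t: "0 < t" "\<And>p. 0 \<le> entry x p + t * entry g p"
    using add_balanced_mem_iff[OF x g] by (auto simp: feasible_direction_def)
  show "\<forall>p. entry g p < 0 \<longrightarrow> 0 < entry x p"
  proof (intro allI impI)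
    fix p assume "entry g p < 0"
    then have "t * entry g p < 0" using t(1) by (simp add: mult_pos_neg)
    then show "0 < entry x p" using t(2)[of p] by linarith
  qed
next
  assume pos: "\<forall>p. entry g p < 0 \<longrightarrow> 0 < entry x p"
  show "feasible_direction (transportation_polytope k n a b) x g"
  proof (cases "g = 0")
    case True
    then show ?thesis using x by (auto simp: feasible_direction_def intro: exI[of _ 1])
  next
    case False
    then show ?thesis
      using transportation_max_step[OF x g False] pos by (auto simp: feasible_direction_def)
  qed
qed

text \<open>The cycles in a conformal decomposition of \<open>z - x\<close> decrease only entries in
  which \<open>z\<close> is smaller than \<open>x\<close>; these are positive at \<open>x\<close>,
  so the cycles are feasible there.\<close>

lemma direction_set_cycle_matrices:
  "direction_set (transportation_polytope k n a b) (cycle_matrices k n)"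
proof
  show "convex (transportation_polytope k n a b)" by (rule convex_transportation_polytope)
  show "finite (cycle_matrices k n)" by (rule finite_cycle_matrices)
  show "0 \<notin> cycle_matrices k n" by (simp add: cycle_matrices_def)
next
  fix x g assume "x \<in> transportation_polytope k n a b" "g \<in> cycle_matrices k n"
    "feasible_direction (transportation_polytope k n a b) x g"
  then show "\<exists>t>0. x + t *\<^sub>R g \<in> transportation_polytope k n a b \<and>
      (\<forall>s>t. x + s *\<^sub>R g \<notin> transportation_polytope k n a b)"
    using transportation_max_step transportation_feasible_direction_iff cycle_matrices_balanced
    by (metis DiffD2 cycle_matrices_def singletonI)
next
  fix x z assume x: "x \<in> transportation_polytope k n a b" and z: "z \<in> transportation_polytope k n a b"
  obtain t where t: "\<forall>g\<in>cycle_matrices k n. 0 \<le> t g \<and> (t g \<noteq> 0 \<longrightarrow> conformal g (z - x))"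
    "z - x = (\<Sum>g\<in>cycle_matrices k n. t g *\<^sub>R g)"
    using conformal_decomposition[OF diff_balanced[OF x z]] by blast
  have "feasible_direction (transportation_polytope k n a b) x g"
    if g: "g \<in> cycle_matrices k n" "conformal g (z - x)" for g
    unfolding transportation_feasible_direction_iff[OF x cycle_matrices_balanced[OF g(1)]]
  proof (intro allI impI)
    fix p assume "entry g p < 0"
    then have "entry (z - x) p < 0" using g(2) unfolding conformal_def by blast
    then show "0 < entry x p" using entry_nonneg[OF z, of p] by (simp add: lookup_minus)
  qed
  moreover have "z = x + (\<Sum>g\<in>cycle_matrices k n. t g *\<^sub>R g)"
    unfolding t(2)[symmetric] by simp
  ultimately show "\<exists>t. (\<forall>g\<in>cycle_matrices k n. 0 \<le> t g \<and>
      (t g \<noteq> 0 \<longrightarrow> feasible_direction (transportation_polytope k n a b) x g)) \<and>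
      z = x + (\<Sum>g\<in>cycle_matrices k n. t g *\<^sub>R g)"
    using t(1) by (intro exI[of _ t]) simp
qed

section \<open>Generic functionals minimized at a vertex\<close>

text \<open>Otherwise \<open>v\<close> could move along both \<open>u\<close> and \<open>- u\<close>
  and would lie inside a segment. In graph terms, the support of a vertex is a forest.\<close>

lemma vertex_support_balanced:
  assumes v: "v \<in> vertices (transportation_polytope k n a b)" and u: "u \<in> balanced k n"
    and supp: "\<And>p. entry v p = 0 \<Longrightarrow> entry u p = 0"
  shows "u = 0"
proof (rule ccontr)
  assume "u \<noteq> 0"
  let ?P = "transportation_polytope k n a b"
  have vP: "v \<in> ?P" and ext: "v extreme_point_of ?P"
    using v by (auto simp: vertices_def extreme_point_of_def)
  have pos: "0 < entry v p" if "entry u p \<noteq> 0" for p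
    using supp[of p] that entry_nonneg[OF vP, of p] by linarith
  have u': "- u \<in> balanced k n"
    using balanced_diff_scaleR[OF u u, of 2] by (simp add: scaleR_2)
  obtain s where s: "0 < s" "v + s *\<^sub>R u \<in> ?P"
    using transportation_max_step[OF vP u \<open>u \<noteq> 0\<close>] pos by (metis less_irrefl)
  obtain t where t: "0 < t" "v + t *\<^sub>R (- u) \<in> ?P"
    using transportation_max_step[OF vP u'] \<open>u \<noteq> 0\<close> pos
    by (metis lookup_uminus less_irrefl neg_0_less_iff_less neg_equal_0_iff_equal)
  have "v \<in> open_segment (v + s *\<^sub>R u) (v + t *\<^sub>R (- u))"
    unfolding in_segment
  \<comment> \<open>The weight \<open>r\<close> with \<open>(1 - r) * s = r * t\<close>.\<close>
  proof (intro conjI exI[of _ "s / (s + t)"])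
    have "v + s *\<^sub>R u - (v + t *\<^sub>R (- u)) = (s + t) *\<^sub>R u" by (simp add: algebra_simps)
    then show "v + s *\<^sub>R u \<noteq> v + t *\<^sub>R (- u)" using s t \<open>u \<noteq> 0\<close> by auto
    show "0 < s / (s + t)" "s / (s + t) < 1" using s t by auto
    have "(1 - s / (s + t)) * s - s / (s + t) * t = 0" using s t by (simp add: field_simps)
    moreover have "(1 - r) *\<^sub>R (v + s *\<^sub>R u) + r *\<^sub>R (v + t *\<^sub>R (- u)) = v + ((1 - r) * s - r * t) *\<^sub>R u" for r
      by (simp add: algebra_simps)
    ultimately show "v = (1 - s / (s + t)) *\<^sub>R (v + s *\<^sub>R u) + (s / (s + t)) *\<^sub>R (v + t *\<^sub>R (- u))"
      by (metis add.right_neutral scaleR_zero_left)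
  qed
  then show False using ext s(2) t(2) unfolding extreme_point_of_def by blast
qed

lemma generic_positive_weights:
  fixes Z :: "'i::countable set" and U :: "('i \<Rightarrow> real) set"
  assumes "finite Z" "finite U" and nonzero: "\<forall>u\<in>U. \<exists>p\<in>Z. u p \<noteq> 0"
  obtains w where "\<forall>p. 0 < w p" "\<forall>u\<in>U. (\<Sum>p\<in>Z. w p * u p) \<noteq> 0"
proof -
  \<comment> \<open>Weights \<open>t ^ to_nat p\<close> turn each \<open>u\<close> into a nonzero polynomial in \<open>t\<close>.\<close>
  define q where "q u = (\<Sum>p\<in>Z. monom (u p) (to_nat p))" for u :: "'i \<Rightarrow> real"
  have "q u \<noteq> 0" if "u \<in> U" for u
  proof -
    obtain p where p: "p \<in> Z" "u p \<noteq> 0" using nonzero \<open>u \<in> U\<close> by blast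
    \<comment> \<open>Injectivity of \<open>to_nat\<close> leaves a single summand in this
      coefficient.\<close>
    have "coeff (q u) (to_nat p) = (\<Sum>p'\<in>Z. if p' = p then u p' else 0)"
      by (simp add: q_def coeff_sum)
    also have "\<dots> \<noteq> 0" using assms(1) p by simp
    finally show ?thesis by auto
  qed
  then have "finite (\<Union>u\<in>U. {t. poly (q u) t = 0})"
    using assms(2) by (intro finite_UN_I poly_roots_finite)
  then obtain t where t: "0 < t" "t \<notin> (\<Union>u\<in>U. {t. poly (q u) t = 0})"
    using infinite_Ioi[of "0::real"] by (metis finite_subset greaterThan_iff subsetI)
  show thesis
  proof
    show "\<forall>p::'i. 0 < t ^ to_nat p" using t(1) by simp
    show "\<forall>u\<in>U. (\<Sum>p\<in>Z. t ^ to_nat p * u p) \<noteq> 0"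
      using t(2) by (simp add: q_def poly_sum poly_monom mult.commute)
  qed
qed

text \<open>A positively weighted sum \<open>d\<close> of the entries that vanish at
  \<open>v\<close> increases along every feasible cycle direction; generic weights keep the
  breakpoints of nonparallel directions apart.\<close>

lemma monotone_distance_transportation_le:
  assumes c: "linear c" and v: "v \<in> vertices (transportation_polytope k n a b)"
  shows "monotone_distance (transportation_polytope k n a b) c v \<le> enat (card (cycle_matrices k n))"
proof -
  let ?P = "transportation_polytope k n a b"
  interpret direction_set ?P "cycle_matrices k n" by (rule direction_set_cycle_matrices)
  interpret c: linear c by fact
  have vP: "v \<in> ?P" using v by (auto simp: vertices_def extreme_point_of_def)
  define Z where "Z = {p \<in> {..<k} \<times> {..<n}. entry v p = 0}"
  have "finite Z" by (simp add: Z_def)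
  have Z: "\<exists>p\<in>Z. entry u p \<noteq> 0" if u: "u \<in> balanced k n" "u \<noteq> 0" for u
  proof -
    obtain p where p: "entry v p = 0" "entry u p \<noteq> 0"
      using vertex_support_balanced[OF v u(1)] u(2) by blast
    then have "p \<in> Z"
      using balanced_entry_bounds[OF u(1)] by (cases p) (auto simp: Z_def)
    then show ?thesis using p(2) by blast
  qed
  \<comment> \<open>Equal breakpoints of \<open>g\<close> and \<open>h\<close> mean that
    \<open>d\<close> vanishes on \<open>c g *\<^sub>R h - c h *\<^sub>R g\<close>. If
    \<open>d\<close> is nonzero on \<open>U\<close>, only parallel pairs can share one.\<close>
  define U where "U = (\<lambda>(g, h). c g *\<^sub>R h - c h *\<^sub>R g) ` (cycle_matrices k n \<times> cycle_matrices k n) - {0}"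
  have "finite U" using finite by (simp add: U_def)
  have U: "u \<in> balanced k n" if "u \<in> U" for u
  proof -
    have "0 \<in> balanced k n" by (simp add: balanced_def)
    then have "r *\<^sub>R g \<in> balanced k n" if "g \<in> balanced k n" for r g
      using balanced_diff_scaleR[of 0 k n g "- r"] that by simp
    then show ?thesis
      using that cycle_matrices_balanced balanced_diff_scaleR by (fastforce simp: U_def)
  qed
  have "\<forall>f\<in>entry ` U. \<exists>p\<in>Z. f p \<noteq> 0"
  proof
    fix f assume "f \<in> entry ` U"
    then obtain u where "f = entry u" "u \<in> U" by blast
    moreover from this have "u \<noteq> 0" by (simp add: U_def)
    ultimately show "\<exists>p\<in>Z. f p \<noteq> 0" using Z U by blast
  qed
  then obtain w where "\<forall>p. 0 < w p" and w: "\<forall>f\<in>entry ` U. (\<Sum>p\<in>Z. w p * f p) \<noteq> 0"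
    by (rule generic_positive_weights[OF \<open>finite Z\<close> finite_imageI[OF \<open>finite U\<close>]])
  then have w_pos: "0 < w p" for p by blast
  define d where "d y = (\<Sum>p\<in>Z. w p * entry y p)" for y
  have d: "linear d"
    by (rule linearI)
      (simp_all add: d_def lookup_add algebra_simps sum.distrib sum_distrib_left)
  interpret d: linear d by fact
  show ?thesis
  proof (rule monotone_distance_le_card[OF c d v])
    fix g h assume gh: "g \<in> cycle_matrices k n" "h \<in> cycle_matrices k n" "c g < 0" "d h * c g = d g * c h"
    have "d (c g *\<^sub>R h - c h *\<^sub>R g) = 0"
      using gh(4) by (simp add: d.diff d.scale mult.commute)
    then have "c g *\<^sub>R h - c h *\<^sub>R g \<notin> U"
      using w unfolding d_def by blast
    then have "c g *\<^sub>R h = c h *\<^sub>R g"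
      using gh by (force simp: U_def)
    then have "h = (c h / c g) *\<^sub>R g"
      using gh(3) by (metis less_irrefl scaleR_left_imp_eq scaleR_scaleR nonzero_mult_div_cancel_left times_divide_eq_right)
    then show "\<exists>s. h = s *\<^sub>R g" by blast
  next
    fix g assume g: "g \<in> cycle_matrices k n" "feasible_direction ?P v g"
    have nonneg: "0 \<le> entry g p" if "p \<in> Z" for p
    proof -
      have "entry v p = 0" using that by (simp add: Z_def)
      then show ?thesis
        using transportation_feasible_direction_iff[OF vP cycle_matrices_balanced[OF g(1)]] g(2)
        by (metis less_irrefl not_le)
    qed
    \<comment> \<open>A feasible direction is nonnegative on \<open>Z\<close> and, being balanced
      and nonzero, does not vanish on all of it.\<close>
    obtain p where "p \<in> Z" "entry g p \<noteq> 0"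
      using Z cycle_matrices_balanced g(1) zero_notin by metis
    then have "0 < w p * entry g p"
      using w_pos nonneg[of p] by (intro mult_pos_pos) auto
    then show "0 < d g"
      unfolding d_def using \<open>finite Z\<close> \<open>p \<in> Z\<close> nonneg w_pos
      by (intro sum_pos2[of Z p]) (simp_all add: less_imp_le)
  qed
qed

section \<open>The bound on the monotone diameter\<close>

lemma mono_diam_transportation_le:
  assumes "is_transportation_polytope k n P"
  shows "ereal_of_enat (mono_diam P) \<le> ereal (exp 1 * fact k * real n ^ k)"
proof -
  obtain a b where P: "P = transportation_polytope k n a b"
    and ab: "\<forall>i<k. 0 < a i" "(\<Sum>i<k. a i) = (\<Sum>j<n. b j)"
    using assms by (auto simp: is_transportation_polytope_def)
  have "mono_diam P \<le> enat (card (cycle_matrices k n))"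
    unfolding mono_diam_def objective_mono_diam_def P
    by (intro SUP_least monotone_distance_transportation_le) (auto simp: nondegenerate_objective_def)
  then have "ereal_of_enat (mono_diam P) \<le> ereal (real (card (cycle_matrices k n)))"
    by (metis ereal_of_enat_le_iff ereal_of_enat_simps(1))
  \<comment> \<open>With rows but no columns, a positive total supply would equal an empty sum of
    demands.\<close>
  moreover have "0 < n \<or> k = 0"
  proof (rule ccontr)
    assume "\<not> (0 < n \<or> k = 0)"
    then have "(\<Sum>i<k. a i) = 0" "0 < k" using ab(2) by auto
    moreover have "0 < (\<Sum>i<k. a i)"
      using ab(1) \<open>0 < k\<close> by (intro sum_pos) auto
    ultimately show False by simp
  qed
  ultimately show ?thesis
    using card_cycle_matrices[of n k] by (meson ereal_less_eq(3) order_trans)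
qed

theorem theorem1p5:
  shows "(\<forall>(k::nat) (n::nat) P. is_transportation_polytope k n P \<longrightarrow>
            ereal_of_enat (mono_diam P) \<le> ereal (exp 1 * fact k * real n ^ k)) \<and>
         (\<forall>k::nat. \<exists>p::real poly. \<forall>(n::nat) P. is_transportation_polytope k n P \<longrightarrow>
            ereal_of_enat (mono_diam P) \<le> ereal (poly p (real n)))"
proof (intro conjI allI impI)
  fix k
  \<comment> \<open>For fixed \<open>k\<close> the bound is itself a monomial of degree
    \<open>k\<close> in \<open>n\<close>.\<close>
  have "\<forall>n P. is_transportation_polytope k n P \<longrightarrow>
      ereal_of_enat (mono_diam P) \<le> ereal (poly (monom (exp 1 * fact k) k) (real n))"
    using mono_diam_transportation_le by (simp add: poly_monom)
  then show "\<exists>p::real poly. \<forall>n P. is_transportation_polytope k n P \<longrightarrow>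
      ereal_of_enat (mono_diam P) \<le> ereal (poly p (real n))"
    by blast
qed (rule mono_diam_transportation_le)

end
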